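(* Let $\mathbf S=(S,\wedge,0)$ be a meet-semilattice with least element $0$ satisfying the Ascending Chain Condition and let $a,b,c\in S$. Then the following hold: (i) $a\rightarrow b$ is an antichain; (ii) $a\leq b$ implies $a\rightarrow b=\operatorname{Max} S$; (iii) $b\in\operatorname{Max} S$ implies $b\in a\rightarrow b$; (iv) $b\leq_1 a\rightarrow b$; (v) $a\leq_1(a\rightarrow b)\rightarrow b$; (vi) $a\leq b$ implies $c\rightarrow a\leq_1 c\rightarrow b$ and $b\rightarrow c\leq_1 a\rightarrow c$; (vii) $a\wedge(a\rightarrow b)\approx_1 a\wedge b$; (viii) $a\rightarrow(b\wedge c)\approx_1(a\rightarrow b)\wedge(a\rightarrow c)$; (ix) $(a\rightarrow b)\wedge b\approx_1 b$; (x) if $\mathbf S$ is bounded (i.e. it also has a greatest element $1$) then $1\rightarrow b=b$; (xi) $a\wedge(b\rightarrow b)\approx_1 a$; (xii) if $\mathbf S$ is bounded then $a\rightarrow b=1$ if and only if $a\leq b$; (xiii) $b\leq_1 a\rightarrow(a\wedge b)$.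
   Context: The Ascending Chain Condition (ACC) means there is no infinite strictly ascending chain; hence every element of any subset $A$ lies below a maximal element of $A$. Singletons are identified with their unique element (one writes $x$ for $\{x\}$). For a subset $A$ of a poset, $\operatorname{Max} A$ denotes the set of all maximal elements of $A$. For subsets $A,B$ of $S$: $A\leq B$ means $a\leq b$ for all $a\in A$ and all $b\in B$; $A\leq_1 B$ means that for every $a\in A$ there exists some $b\in B$ with $a\leq b$; $A\approx_1 B$ means $A\leq_1 B$ and $B\leq_1 A$; and $A\wedge B:=\{a\wedge b\mid a\in A,\ b\in B\}$. When an element of $S$ occurs in one of these notations it stands for the corresponding singleton. For $a,b\in S$ define the (unsharp implication) subset $a\rightarrow b:=\operatorname{Max}\{x\in S\mid a\wedge x\leq b\}$ of $S$, and for $A,B\subseteq S$ define $A\rightarrow B:=\operatorname{Max}\{x\in S\mid A\wedge x\leq B\}$. The symbols $\leq_1$ and $\approx_1$ bind weaker than $\rightarrow$ and $\wedge$. *)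

theory Defs
  imports Main
begin

text \<open>
  All operations below act on subsets. An element that occurs in one of them is written as the
  corresponding singleton, so that \<open>{a} \<^bold>\<rightarrow> {b}\<close> is the implication of two elements; see
  \<open>unsharp_imp_singletons\<close>.
\<close>

definition maximals :: "'a::order set \<Rightarrow> 'a set" where
  "maximals A = {x \<in> A. \<not> (\<exists>y\<in>A. x < y)}"

definition antichain :: "'a::order set \<Rightarrow> bool" where
  "antichain A \<longleftrightarrow> (\<forall>x\<in>A. \<forall>y\<in>A. x \<noteq> y \<longrightarrow> \<not> x \<le> y \<and> \<not> y \<le> x)"

definition all_le :: "'a::order set \<Rightarrow> 'a set \<Rightarrow> bool" where
  "all_le A B \<longleftrightarrow> (\<forall>a\<in>A. \<forall>b\<in>B. a \<le> b)"

definition le1 :: "'a::order set \<Rightarrow> 'a set \<Rightarrow> bool"  (infix \<open>\<le>\<^sub>1\<close> 50) where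
  "A \<le>\<^sub>1 B \<longleftrightarrow> (\<forall>a\<in>A. \<exists>b\<in>B. a \<le> b)"

definition approx1 :: "'a::order set \<Rightarrow> 'a set \<Rightarrow> bool"  (infix \<open>\<approx>\<^sub>1\<close> 50) where
  "A \<approx>\<^sub>1 B \<longleftrightarrow> A \<le>\<^sub>1 B \<and> B \<le>\<^sub>1 A"

definition set_meet :: "'a::semilattice_inf set \<Rightarrow> 'a set \<Rightarrow> 'a set"
    (infixl \<open>\<^bold>\<and>\<close> 70) where
  "A \<^bold>\<and> B = {inf a b | a b. a \<in> A \<and> b \<in> B}"

definition unsharp_imp :: "'a::semilattice_inf set \<Rightarrow> 'a set \<Rightarrow> 'a set"
    (infixr \<open>\<^bold>\<rightarrow>\<close> 60) where
  "A \<^bold>\<rightarrow> B = maximals {x. all_le (A \<^bold>\<and> {x}) B}"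

lemma unsharp_imp_singletons: "{a} \<^bold>\<rightarrow> {b} = maximals {x. inf a x \<le> b}"
  by (simp add: unsharp_imp_def set_meet_def all_le_def)

end

theory Submission
  imports Defs
begin

text \<open>
  The unsharp implication is a set-valued residual of the meet: under the Ascending Chain
  Condition every \<open>x\<close> with \<open>A \<^bold>\<and> {x}\<close> below \<open>B\<close> lies below a maximal such \<open>x\<close>, so
  \<open>{x} \<le>\<^sub>1 A \<^bold>\<rightarrow> B\<close> holds exactly when \<open>A \<^bold>\<and> {x}\<close> is below \<open>B\<close>
  (\<open>le1_unsharp_imp_iff\<close>; for single elements, \<open>le1_imp_iff\<close>). This is the adjunction of
  relatively pseudocomplemented semilattices, with \<open>\<le>\<close> replaced by \<open>\<le>\<^sub>1\<close>.

  Hence the properties that are stated with \<open>\<le>\<^sub>1\<close> or \<open>\<approx>\<^sub>1\<close> follow as in a Heyting algebra: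
  upper bounds on a meet with \<open>{a} \<^bold>\<rightarrow> {b}\<close> come from \<open>inf a y \<le> b\<close> for its members \<open>y\<close>, and
  lower bounds from the adjunction. The properties that are stated as equalities or memberships
  concern a set \<open>{x. inf a x \<le> b}\<close> of a special shape: it is everything if and only if
  \<open>a \<le> b\<close>, it is the down-set of \<open>b\<close> if \<open>a\<close> is the greatest element, and it always contains \<open>b\<close>.
\<close>

text \<open>
  The Ascending Chain Condition says that the converse of \<open><\<close> is well-founded, and a minimal
  element for that converse among the members of \<open>A\<close> above \<open>x\<close> is maximal in \<open>A\<close>.
\<close>

lemma ex_maximal_above:
  fixes x :: "'a::order"
  assumes acc: "\<not> (\<exists>f :: nat \<Rightarrow> 'a. \<forall>n. f n < f (Suc n))" and "x \<in> A"
  shows "\<exists>y\<in>maximals A. x \<le> y"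
proof -
  have "wf {(v, u::'a). u < v}"
    using acc by (simp add: wf_iff_no_infinite_down_chain)
  moreover have "x \<in> {y \<in> A. x \<le> y}"
    using \<open>x \<in> A\<close> by simp
  ultimately obtain y where "y \<in> {y \<in> A. x \<le> y}"
    and max: "\<And>z. (z, y) \<in> {(v, u). u < v} \<Longrightarrow> z \<notin> {y \<in> A. x \<le> y}"
    by (rule wfE_min) blast
  then have "y \<in> maximals A" "x \<le> y"
    unfolding maximals_def by (auto dest: order.strict_implies_order order_trans)
  then show ?thesis
    by blast
qed

lemma antichain_maximals: "antichain (maximals A)"
  unfolding antichain_def maximals_def by (auto simp: less_le)

lemma maximals_UNIV_greatest:
  fixes t :: "'a::order"
  assumes "\<And>x. x \<le> t"
  shows "maximals UNIV = {t}"
  using assms by (auto simp: maximals_def less_le intro: antisym)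

lemma maximals_atMost: "maximals {..b::'a::order} = {b}"
  by (auto simp: maximals_def less_le intro: antisym)

lemma le1_iff_singletons: "A \<le>\<^sub>1 B \<longleftrightarrow> (\<forall>x\<in>A. {x} \<le>\<^sub>1 B)"
  by (simp add: le1_def)

text \<open>
  From left to right, \<open>x\<close> lies below a member of \<open>A \<^bold>\<rightarrow> B\<close>, and the condition that defines
  those members is inherited by smaller elements; from right to left, the Ascending Chain
  Condition provides a maximal element above \<open>x\<close>.
\<close>

lemma le1_unsharp_imp_iff:
  fixes A B :: "'a::semilattice_inf set"
  assumes acc: "\<not> (\<exists>f :: nat \<Rightarrow> 'a. \<forall>n. f n < f (Suc n))"
  shows "{x} \<le>\<^sub>1 A \<^bold>\<rightarrow> B \<longleftrightarrow> all_le (A \<^bold>\<and> {x}) B"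
proof
  assume "{x} \<le>\<^sub>1 A \<^bold>\<rightarrow> B"
  then obtain y where "x \<le> y" and y: "all_le (A \<^bold>\<and> {y}) B"
    by (auto simp: le1_def unsharp_imp_def maximals_def)
  then have "inf u x \<le> v" if "u \<in> A" "v \<in> B" for u v
    using that by (auto simp: all_le_def set_meet_def intro: order_trans[OF inf_mono[OF order_refl]])
  then show "all_le (A \<^bold>\<and> {x}) B"
    by (auto simp: all_le_def set_meet_def)
next
  assume "all_le (A \<^bold>\<and> {x}) B"
  then show "{x} \<le>\<^sub>1 A \<^bold>\<rightarrow> B"
    using ex_maximal_above[OF acc, of x "{x. all_le (A \<^bold>\<and> {x}) B}"]
    by (simp add: le1_def unsharp_imp_def)
qed

lemma le1_imp_iff:
  fixes a b x :: "'a::semilattice_inf"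
  assumes "\<not> (\<exists>f :: nat \<Rightarrow> 'a. \<forall>n. f n < f (Suc n))"
  shows "{x} \<le>\<^sub>1 {a} \<^bold>\<rightarrow> {b} \<longleftrightarrow> inf a x \<le> b"
  by (simp add: le1_unsharp_imp_iff[OF assms] all_le_def set_meet_def)

text \<open>Modus ponens for the members of an implication.\<close>

lemma inf_le_if_mem_imp: "x \<in> {a} \<^bold>\<rightarrow> {b} \<Longrightarrow> inf a x \<le> b"
  by (simp add: unsharp_imp_singletons maximals_def)

lemma imp_eq_maximals_UNIV: "a \<le> b \<Longrightarrow> {a} \<^bold>\<rightarrow> {b} = maximals UNIV"
  by (simp add: unsharp_imp_singletons le_infI1)

lemma greatest_imp:
  fixes t b :: "'a::semilattice_inf"
  assumes "\<And>x. x \<le> t"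
  shows "{t} \<^bold>\<rightarrow> {b} = {b}"
proof -
  have "{x. inf t x \<le> b} = {..b}"
    using assms by (simp add: inf_absorb2 atMost_def)
  then show ?thesis
    by (simp add: unsharp_imp_singletons maximals_atMost)
qed

lemma imp_eq_greatest_iff:
  fixes t a b :: "'a::semilattice_inf"
  assumes "\<And>x. x \<le> t"
  shows "{a} \<^bold>\<rightarrow> {b} = {t} \<longleftrightarrow> a \<le> b"
proof
  assume "{a} \<^bold>\<rightarrow> {b} = {t}"
  then have "inf a t \<le> b"
    by (intro inf_le_if_mem_imp) simp
  then show "a \<le> b"
    using assms by (simp add: inf_absorb1)
next
  assume "a \<le> b"
  then show "{a} \<^bold>\<rightarrow> {b} = {t}"
    using imp_eq_maximals_UNIV maximals_UNIV_greatest[OF assms] by blast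
qed

text \<open>
  The inequality \<open>inf a x \<le> b\<close> survives lowering \<open>a\<close> and raising \<open>b\<close>, so the adjunction places
  each member \<open>x\<close> of the first implication below a member of the second.
\<close>

lemma imp_le1_imp:
  fixes a a' b b' :: "'a::semilattice_inf"
  assumes acc: "\<not> (\<exists>f :: nat \<Rightarrow> 'a. \<forall>n. f n < f (Suc n))" and "a' \<le> a" "b \<le> b'"
  shows "{a} \<^bold>\<rightarrow> {b} \<le>\<^sub>1 {a'} \<^bold>\<rightarrow> {b'}"
proof -
  have "inf a' x \<le> b'" if "x \<in> {a} \<^bold>\<rightarrow> {b}" for x
  proof -
    have "inf a' x \<le> inf a x"
      using \<open>a' \<le> a\<close> by (rule inf_mono) simp
    also have "\<dots> \<le> b"
      using that by (rule inf_le_if_mem_imp)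
    finally show ?thesis
      using \<open>b \<le> b'\<close> by simp
  qed
  then show ?thesis
    unfolding le1_iff_singletons[of "{a} \<^bold>\<rightarrow> {b}"] le1_imp_iff[OF acc] by blast
qed

lemma le1_double_imp:
  fixes a b :: "'a::semilattice_inf"
  assumes acc: "\<not> (\<exists>f :: nat \<Rightarrow> 'a. \<forall>n. f n < f (Suc n))"
  shows "{a} \<le>\<^sub>1 ({a} \<^bold>\<rightarrow> {b}) \<^bold>\<rightarrow> {b}"
  unfolding le1_unsharp_imp_iff[OF acc]
  by (auto simp: all_le_def set_meet_def inf.commute dest: inf_le_if_mem_imp)

text \<open>
  The nontrivial direction needs a member of \<open>{a} \<^bold>\<rightarrow> {b}\<close> above \<open>inf a b\<close>; by the
  adjunction there is even one above \<open>b\<close>.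
\<close>

lemma meet_imp_approx1:
  fixes a b :: "'a::semilattice_inf"
  assumes acc: "\<not> (\<exists>f :: nat \<Rightarrow> 'a. \<forall>n. f n < f (Suc n))"
  shows "{a} \<^bold>\<and> ({a} \<^bold>\<rightarrow> {b}) \<approx>\<^sub>1 {inf a b}"
proof -
  have "{b} \<le>\<^sub>1 {a} \<^bold>\<rightarrow> {b}"
    by (simp add: le1_imp_iff[OF acc])
  then obtain y where "y \<in> {a} \<^bold>\<rightarrow> {b}" "b \<le> y"
    by (auto simp: le1_def)
  then have "{inf a b} \<le>\<^sub>1 {a} \<^bold>\<and> ({a} \<^bold>\<rightarrow> {b})"
    unfolding le1_def set_meet_def using inf_mono[OF order_refl] by blast
  then show ?thesis
    by (auto simp: approx1_def le1_def set_meet_def dest: inf_le_if_mem_imp)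
qed

lemma imp_meet_approx1:
  fixes a b :: "'a::semilattice_inf"
  assumes acc: "\<not> (\<exists>f :: nat \<Rightarrow> 'a. \<forall>n. f n < f (Suc n))"
  shows "({a} \<^bold>\<rightarrow> {b}) \<^bold>\<and> {b} \<approx>\<^sub>1 {b}"
proof -
  have "{b} \<le>\<^sub>1 {a} \<^bold>\<rightarrow> {b}"
    by (simp add: le1_imp_iff[OF acc])
  then show ?thesis
    by (auto simp: approx1_def le1_def set_meet_def)
qed

text \<open>
  Both halves rest on the fact that \<open>inf a x \<le> inf b c\<close> holds if and only if both
  \<open>inf a x \<le> b\<close> and \<open>inf a x \<le> c\<close> do. A member of the left-hand side lies below a member of
  each implication on the right, hence below their meet, and such a meet satisfies both
  inequalities.
\<close>

lemma imp_inf_approx1: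
  fixes a b c :: "'a::semilattice_inf"
  assumes acc: "\<not> (\<exists>f :: nat \<Rightarrow> 'a. \<forall>n. f n < f (Suc n))"
  shows "{a} \<^bold>\<rightarrow> {inf b c} \<approx>\<^sub>1 ({a} \<^bold>\<rightarrow> {b}) \<^bold>\<and> ({a} \<^bold>\<rightarrow> {c})"
    (is "?L \<approx>\<^sub>1 ?B \<^bold>\<and> ?C")
proof -
  have "?L \<le>\<^sub>1 ?B" "?L \<le>\<^sub>1 ?C"
    by (simp_all add: imp_le1_imp[OF acc])
  then have "\<exists>y\<in>?B. \<exists>z\<in>?C. x \<le> inf y z" if "x \<in> ?L" for x
    using that unfolding le1_def le_inf_iff by blast
  then have "?L \<le>\<^sub>1 ?B \<^bold>\<and> ?C"
    unfolding le1_def set_meet_def by blast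
  moreover have "{inf y z} \<le>\<^sub>1 ?L" if "y \<in> ?B" "z \<in> ?C" for y z
  proof -
    have "inf a (inf y z) \<le> inf a y" "inf a (inf y z) \<le> inf a z"
      by (simp_all add: le_infI2)
    then have "inf a (inf y z) \<le> inf b c"
      using inf_le_if_mem_imp[OF \<open>y \<in> ?B\<close>] inf_le_if_mem_imp[OF \<open>z \<in> ?C\<close>]
      by (blast intro: le_infI order_trans)
    then show ?thesis
      by (simp only: le1_imp_iff[OF acc])
  qed
  then have "?B \<^bold>\<and> ?C \<le>\<^sub>1 ?L"
    unfolding le1_iff_singletons[of "?B \<^bold>\<and> ?C"] by (auto simp: set_meet_def)
  ultimately show ?thesis
    by (simp add: approx1_def)
qed

text \<open>The members of \<open>{b} \<^bold>\<rightarrow> {b}\<close> are all the maximal elements, and one of them is above \<open>a\<close>.\<close>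

lemma meet_imp_self_approx1:
  fixes a b :: "'a::semilattice_inf"
  assumes acc: "\<not> (\<exists>f :: nat \<Rightarrow> 'a. \<forall>n. f n < f (Suc n))"
  shows "{a} \<^bold>\<and> ({b} \<^bold>\<rightarrow> {b}) \<approx>\<^sub>1 {a}"
proof -
  have "{a} \<le>\<^sub>1 {b} \<^bold>\<rightarrow> {b}"
    by (simp add: le1_imp_iff[OF acc])
  then show ?thesis
    by (auto simp: approx1_def le1_def set_meet_def)
qed

theorem theorem4p3:
  fixes a b c :: "'a::{semilattice_inf, order_bot}"
  assumes acc: "\<not> (\<exists>f :: nat \<Rightarrow> 'a. \<forall>n. f n < f (Suc n))"
  shows
    "antichain ({a} \<^bold>\<rightarrow> {b}) \<and>
     (a \<le> b \<longrightarrow> {a} \<^bold>\<rightarrow> {b} = maximals UNIV) \<and>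
     (b \<in> maximals UNIV \<longrightarrow> b \<in> {a} \<^bold>\<rightarrow> {b}) \<and>
     ({b} \<le>\<^sub>1 {a} \<^bold>\<rightarrow> {b}) \<and>
     ({a} \<le>\<^sub>1 ({a} \<^bold>\<rightarrow> {b}) \<^bold>\<rightarrow> {b}) \<and>
     (a \<le> b \<longrightarrow> ({c} \<^bold>\<rightarrow> {a} \<le>\<^sub>1 {c} \<^bold>\<rightarrow> {b}) \<and> ({b} \<^bold>\<rightarrow> {c} \<le>\<^sub>1 {a} \<^bold>\<rightarrow> {c})) \<and>
     ({a} \<^bold>\<and> ({a} \<^bold>\<rightarrow> {b}) \<approx>\<^sub>1 {inf a b}) \<and>
     ({a} \<^bold>\<rightarrow> {inf b c} \<approx>\<^sub>1 ({a} \<^bold>\<rightarrow> {b}) \<^bold>\<and> ({a} \<^bold>\<rightarrow> {c})) \<and>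
     (({a} \<^bold>\<rightarrow> {b}) \<^bold>\<and> {b} \<approx>\<^sub>1 {b}) \<and>
     (\<forall>t::'a. (\<forall>x. x \<le> t) \<longrightarrow> {t} \<^bold>\<rightarrow> {b} = {b}) \<and>
     ({a} \<^bold>\<and> ({b} \<^bold>\<rightarrow> {b}) \<approx>\<^sub>1 {a}) \<and>
     (\<forall>t::'a. (\<forall>x. x \<le> t) \<longrightarrow> ({a} \<^bold>\<rightarrow> {b} = {t} \<longleftrightarrow> a \<le> b)) \<and>
     ({b} \<le>\<^sub>1 {a} \<^bold>\<rightarrow> {inf a b})"
proof (intro conjI impI allI)
  show "antichain ({a} \<^bold>\<rightarrow> {b})"
    unfolding unsharp_imp_def by (rule antichain_maximals)
  show "a \<le> b \<Longrightarrow> {a} \<^bold>\<rightarrow> {b} = maximals UNIV"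
    by (rule imp_eq_maximals_UNIV)
  show "b \<in> maximals UNIV \<Longrightarrow> b \<in> {a} \<^bold>\<rightarrow> {b}"
    by (simp add: unsharp_imp_singletons maximals_def)
  show "{b} \<le>\<^sub>1 {a} \<^bold>\<rightarrow> {b}" "{b} \<le>\<^sub>1 {a} \<^bold>\<rightarrow> {inf a b}"
    by (simp_all add: le1_imp_iff[OF acc])
  show "{a} \<le>\<^sub>1 ({a} \<^bold>\<rightarrow> {b}) \<^bold>\<rightarrow> {b}"
    by (rule le1_double_imp[OF acc])
  show "a \<le> b \<Longrightarrow> {c} \<^bold>\<rightarrow> {a} \<le>\<^sub>1 {c} \<^bold>\<rightarrow> {b}" "a \<le> b \<Longrightarrow> {b} \<^bold>\<rightarrow> {c} \<le>\<^sub>1 {a} \<^bold>\<rightarrow> {c}"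
    by (simp_all add: imp_le1_imp[OF acc])
  show "{a} \<^bold>\<and> ({a} \<^bold>\<rightarrow> {b}) \<approx>\<^sub>1 {inf a b}"
    by (rule meet_imp_approx1[OF acc])
  show "{a} \<^bold>\<rightarrow> {inf b c} \<approx>\<^sub>1 ({a} \<^bold>\<rightarrow> {b}) \<^bold>\<and> ({a} \<^bold>\<rightarrow> {c})"
    by (rule imp_inf_approx1[OF acc])
  show "({a} \<^bold>\<rightarrow> {b}) \<^bold>\<and> {b} \<approx>\<^sub>1 {b}"
    by (rule imp_meet_approx1[OF acc])
  show "{a} \<^bold>\<and> ({b} \<^bold>\<rightarrow> {b}) \<approx>\<^sub>1 {a}"
    by (rule meet_imp_self_approx1[OF acc])
  show "{t} \<^bold>\<rightarrow> {b} = {b}" if "\<forall>x. x \<le> t" for t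
    using that by (simp add: greatest_imp)
  show "{a} \<^bold>\<rightarrow> {b} = {t} \<longleftrightarrow> a \<le> b" if "\<forall>x. x \<le> t" for t
    using that by (simp add: imp_eq_greatest_iff)
qed

end
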